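(* Let $N_1\in(0,N)$ be the unique number with $\int_0^{N_1}\beta(n)\,dn=\int_{N_1}^N\gamma(n)\,dn$, let $\tau_s=-N_1/s$ and $\tau_e=\tau_s+N/s$, and let $n(t)=N_1+st$ for $t\in[\tau_s,\tau_e]$. Then the arrival time ordering $$t(n)=\frac{n-N_1}{s},\qquad n\in[0,N],$$ and the queueing profile $$Q(t)=\begin{cases}\dfrac1s\displaystyle\int_0^{n(t)}\beta(n)\,dn, & t\in[\tau_s,0],\\[2mm] Q(0)-\dfrac1s\displaystyle\int_{N_1}^{n(t)}\gamma(n)\,dn,& t\in(0,\tau_e],\end{cases}$$ with $Q(t)=0$ for $t\in\mathcal{T}\setminus[\tau_s,\tau_e]$, where $\mathcal{T}=[-N/s,N/s]$, satisfy the equilibrium principle: for all $n\in[0,N]$, $$C_n(t(n))=\min_{u\in\mathcal{T}}C_n(u).$$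
   Context: $N>0$ (mass of travelers) and $s>0$ (bottleneck capacity) are real numbers. Travelers are indexed by $n\in[0,N]$. $\beta:[0,N]\to(0,1)$ is continuous and strictly increasing (earliness penalty), and $\gamma:[0,N]\to(0,\infty)$ is continuous and strictly decreasing (lateness penalty). Time is measured relative to the preferred arrival time $0$. Write $[x]^+=\max\{x,0\}$. Given a queueing delay profile $Q$ on $\mathcal{T}$, where $Q(t)$ is the queueing delay of a traveler arriving at $t$, the cost of traveler $n$ when arriving at time $t$ is $C_n(t)=Q(t)+\beta(n)[-t]^+ +\gamma(n)[t]^+$. The function $t(n)$ gives the arrival time of traveler $n$. *)

theory Defs
  imports "HOL-Analysis.Analysis"
begin

definition pos_part :: "real \<Rightarrow> real" where
  "pos_part x = max x 0"

definition time_window :: "real \<Rightarrow> real \<Rightarrow> real set" where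
  "time_window N s = {- N / s .. N / s}"

definition travel_cost ::
  "(real \<Rightarrow> real) \<Rightarrow> (real \<Rightarrow> real) \<Rightarrow> (real \<Rightarrow> real) \<Rightarrow> real \<Rightarrow> real \<Rightarrow> real" where
  "travel_cost \<beta> \<gamma> Q n t = Q t + \<beta> n * pos_part (- t) + \<gamma> n * pos_part t"

text \<open>
  As the infinite set of arrival times has no built-in minimum operator, the statement
  that the cost at \<open>\<theta> n\<close> equals the minimum over the time window is
  expressed by \<open>\<theta> n\<close> being a feasible minimizer.
\<close>

definition equilibrium_principle ::
  "real \<Rightarrow> real \<Rightarrow> (real \<Rightarrow> real) \<Rightarrow> (real \<Rightarrow> real) \<Rightarrow> (real \<Rightarrow> real) \<Rightarrow> (real \<Rightarrow> real) \<Rightarrow> bool" where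
  "equilibrium_principle N s \<beta> \<gamma> \<theta> Q \<longleftrightarrow>
     (\<forall>n\<in>{0..N}. is_arg_min (travel_cost \<beta> \<gamma> Q n) (\<lambda>u. u \<in> time_window N s) (\<theta> n))"

definition balanced_split ::
  "real \<Rightarrow> (real \<Rightarrow> real) \<Rightarrow> (real \<Rightarrow> real) \<Rightarrow> real \<Rightarrow> bool" where
  "balanced_split N \<beta> \<gamma> N1 \<longleftrightarrow>
     N1 \<in> {0<..<N} \<and> integral {0..N1} \<beta> = integral {N1..N} \<gamma>"

definition start_time :: "real \<Rightarrow> real \<Rightarrow> real" where
  "start_time s N1 = - N1 / s"

definition end_time :: "real \<Rightarrow> real \<Rightarrow> real \<Rightarrow> real" where
  "end_time N s N1 = start_time s N1 + N / s"

definition traveler_at :: "real \<Rightarrow> real \<Rightarrow> real \<Rightarrow> real" where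
  "traveler_at s N1 t = N1 + s * t"

definition arrival_time :: "real \<Rightarrow> real \<Rightarrow> real \<Rightarrow> real" where
  "arrival_time s N1 n = (n - N1) / s"

definition early_delay :: "real \<Rightarrow> (real \<Rightarrow> real) \<Rightarrow> real \<Rightarrow> real \<Rightarrow> real" where
  "early_delay s \<beta> N1 t = (1 / s) * integral {0..traveler_at s N1 t} \<beta>"

text \<open>
  The term \<open>early_delay s \<beta> N1 0\<close> is the value of the profile at time 0.
  In each branch the upper limit of integration is at least the lower one, so the
  set integrals agree with the oriented ones.
\<close>

definition queue_delay ::
  "real \<Rightarrow> real \<Rightarrow> (real \<Rightarrow> real) \<Rightarrow> (real \<Rightarrow> real) \<Rightarrow> real \<Rightarrow> real \<Rightarrow> real" where
  "queue_delay N s \<beta> \<gamma> N1 t =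
     (if t \<in> {start_time s N1..0} then early_delay s \<beta> N1 t
      else if t \<in> {0<..end_time N s N1}
        then early_delay s \<beta> N1 0 - (1 / s) * integral {N1..traveler_at s N1 t} \<gamma>
      else 0)"

end

(* Measure an arrival time u by the traveler x = N1 + s u served at u. By the balance condition,
   s times the cost of traveler n becomes the integral of \<beta> over [0, x] plus \<beta>(n) (N1 - x) for
   x \<le> N1, and the integral of \<gamma> over [x, N] plus \<gamma>(n) (x - N1) for x \<ge> N1. Its slopes are
   \<beta>(x) - \<beta>(n) and \<gamma>(n) - \<gamma>(x). By monotonicity of \<beta> and \<gamma> it is therefore convex on either
   side of N1, stationary at x = n, and, on the side of N1 not containing n, it grows away from N1. *)
theory Submission
  imports Defs
begin

text \<open>An integral with increasing integrand is a convex function of its upper limit, so its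
  graph lies above the tangent at \<open>p\<close>, whose slope is \<open>f p\<close>. The point
  \<open>q\<close> may lie to the left of \<open>a\<close>, which later covers arrivals before the
  rush hour.\<close>

lemma integral_increasing_tangent:
  fixes f :: "real \<Rightarrow> real"
  assumes int: "f integrable_on {a..b}" and mono: "mono_on {a..b} f"
    and nonneg: "\<And>x. x \<in> {a..b} \<Longrightarrow> 0 \<le> f x"
    and p: "p \<in> {a..b}" and q: "q \<le> b"
  shows "integral {a..p} f + f p * (q - p) \<le> integral {a..q} f"
proof -
  have sub: "f integrable_on {c..d}" if "a \<le> c" "d \<le> b" for c d
    using int by (rule integrable_on_subinterval) (use that in auto)
  have inside: "integral {a..p} f + f p * (q - p) \<le> integral {a..q} f"
    if q: "q \<in> {a..b}" for q
  proof (cases "p \<le> q")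
    case True
    have "integral {p..q} (\<lambda>_. f p) \<le> integral {p..q} f"
      by (rule integral_le) (use p q True sub in \<open>auto intro!: mono_onD[OF mono]\<close>)
    moreover have "integral {a..p} f + integral {p..q} f = integral {a..q} f"
      by (rule Henstock_Kurzweil_Integration.integral_combine) (use p q True sub in auto)
    ultimately show ?thesis using True by (simp add: mult.commute)
  next
    case False
    have "integral {q..p} f \<le> integral {q..p} (\<lambda>_. f p)"
      by (rule integral_le) (use p q False sub in \<open>auto intro!: mono_onD[OF mono]\<close>)
    moreover have "integral {a..q} f + integral {q..p} f = integral {a..p} f"
      by (rule Henstock_Kurzweil_Integration.integral_combine) (use p q False sub in auto)
    ultimately show ?thesis using False by (simp add: algebra_simps)
  qed
  show ?thesis
  proof (cases "a \<le> q")
    case True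
    then show ?thesis using inside q by simp
  next
    case False
    \<comment> \<open>For \<open>q < a\<close> the integral over \<open>{a..q}\<close> is 0, the
      same as at \<open>a\<close>, while the tangent, of slope \<open>f p \<ge> 0\<close>, is no
      higher at \<open>q\<close> than at \<open>a\<close>.\<close>
    have "f p * (q - p) \<le> f p * (a - p)"
      using False nonneg[OF p] by (intro mult_left_mono) auto
    then show ?thesis using inside[of a] p False by simp
  qed
qed

text \<open>Mirror image of the previous lemma under the reflection of \<open>x\<close> to
  \<open>-x\<close>; now \<open>q\<close> may exceed \<open>b\<close>.\<close>

lemma integral_decreasing_tangent:
  fixes f :: "real \<Rightarrow> real"
  assumes int: "f integrable_on {a..b}" and anti: "antimono_on {a..b} f"
    and nonneg: "\<And>x. x \<in> {a..b} \<Longrightarrow> 0 \<le> f x"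
    and p: "p \<in> {a..b}" and q: "a \<le> q"
  shows "integral {p..b} f \<le> integral {q..b} f + f p * (q - p)"
proof -
  have "mono_on {-b..-a} (\<lambda>x. f (- x))"
    using anti by (auto simp: monotone_on_def)
  then have "integral {-b..-p} (\<lambda>x. f (- x)) + f p * (-q - -p)
      \<le> integral {-b..-q} (\<lambda>x. f (- x))"
    using integral_increasing_tangent[of "\<lambda>x. f (- x)" "-b" "-a" "-p" "-q"] int nonneg p q by auto
  then show ?thesis by (simp add: algebra_simps)
qed

locale bottleneck =
  fixes N s :: real and \<beta> \<gamma> :: "real \<Rightarrow> real"
  assumes N_pos: "N > 0" and s_pos: "s > 0"
    and cont_early: "continuous_on {0..N} \<beta>" and strict_early: "strict_mono_on {0..N} \<beta>"
    and pos_early: "\<And>x. x \<in> {0..N} \<Longrightarrow> 0 < \<beta> x"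
    and cont_late: "continuous_on {0..N} \<gamma>" and strict_late: "strict_antimono_on {0..N} \<gamma>"
    and pos_late: "\<And>x. x \<in> {0..N} \<Longrightarrow> 0 < \<gamma> x"
begin

lemma mono_early: "mono_on {0..N} \<beta>"
  using strict_early by (rule strict_mono_on_imp_mono_on)

lemma antimono_late: "antimono_on {0..N} \<gamma>"
  using strict_late by (force simp: monotone_on_def le_less)

lemmas early_tangent =
  integral_increasing_tangent[OF integrable_continuous_interval[OF cont_early] mono_early
    less_imp_le[OF pos_early]]

lemmas late_tangent =
  integral_decreasing_tangent[OF integrable_continuous_interval[OF cont_late] antimono_late
    less_imp_le[OF pos_late]]

text \<open>The tangent at \<open>p\<close> has the positive slope \<open>\<beta> p\<close>, so it
  already rises strictly from \<open>p\<close> to \<open>q\<close>.\<close>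

lemma early_integral_strict_mono:
  assumes "0 \<le> p" "p < q" "q \<le> N"
  shows "integral {0..p} \<beta> < integral {0..q} \<beta>"
  using early_tangent[of p q] mult_pos_pos[OF pos_early[of p], of "q - p"] assms by auto

lemma late_integral_strict_antimono:
  assumes "0 \<le> p" "p < q" "q \<le> N"
  shows "integral {q..N} \<gamma> < integral {p..N} \<gamma>"
  using late_tangent[of q p] mult_pos_pos[OF pos_late[of q], of "q - p"] assms
  by (auto simp: algebra_simps)

text \<open>Existence comes from the intermediate value theorem for the difference \<open>h\<close>
  of the two sides. Uniqueness holds because moving the split to the right raises the \<beta>
  integral and lowers the \<gamma> integral, both strictly.\<close>

lemma ex1_balanced_split: "\<exists>!N1. balanced_split N \<beta> \<gamma> N1"
proof (rule ex_ex1I)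
  define h where "h x = integral {0..x} \<beta> - integral {x..N} \<gamma>" for x
  have "continuous_on {0..N} h"
    unfolding h_def
    by (intro continuous_intros indefinite_integral_continuous_1 indefinite_integral_continuous_1'
        integrable_continuous_interval cont_early cont_late)
  moreover have h0: "h 0 < 0"
    using late_integral_strict_antimono[of 0 N] N_pos by (simp add: h_def)
  moreover have hN: "h N > 0"
    using early_integral_strict_mono[of 0 N] N_pos by (simp add: h_def)
  ultimately obtain x where x: "0 \<le> x" "x \<le> N" "h x = 0"
    using IVT'[of h 0 0 N] N_pos by auto
  \<comment> \<open>The strict signs of \<open>h\<close> at the ends place the root in the open
    interval.\<close>
  then have "x \<noteq> 0" "x \<noteq> N" using h0 hN by auto
  with x show "\<exists>N1. balanced_split N \<beta> \<gamma> N1"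
    by (intro exI[of _ x]) (auto simp: balanced_split_def h_def)
next
  fix x y
  assume x: "balanced_split N \<beta> \<gamma> x" and y: "balanced_split N \<beta> \<gamma> y"
  have "\<not> v < w" if "balanced_split N \<beta> \<gamma> v" "balanced_split N \<beta> \<gamma> w" for v w
    using that early_integral_strict_mono[of v w] late_integral_strict_antimono[of v w]
    by (auto simp: balanced_split_def)
  with x y show "x = y" by (meson linorder_neqE)
qed

text \<open>
  Outside the rush hour the integration intervals below are degenerate, which yields exactly
  the required zero delay.
\<close>

lemma queue_delay_eq:
  assumes bal: "balanced_split N \<beta> \<gamma> N1"
  shows "s * queue_delay N s \<beta> \<gamma> N1 ((x - N1) / s) =
    (if x \<le> N1 then integral {0..x} \<beta> else integral {x..N} \<gamma>)"
proof -
  have N1: "0 < N1" "N1 < N" and eq: "integral {0..N1} \<beta> = integral {N1..N} \<gamma>"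
    using bal by (auto simp: balanced_split_def)
  have early: "(x - N1) / s \<in> {start_time s N1..0} \<longleftrightarrow> 0 \<le> x \<and> x \<le> N1"
    using s_pos by (auto simp: start_time_def field_simps)
  have late: "(x - N1) / s \<in> {0<..end_time N s N1} \<longleftrightarrow> N1 < x \<and> x \<le> N"
    using s_pos by (auto simp: end_time_def start_time_def field_simps)
  have at: "traveler_at s N1 ((x - N1) / s) = x" "traveler_at s N1 0 = N1"
    using s_pos by (auto simp: traveler_at_def)
  \<comment> \<open>By balance, \<open>s\<close> times the delay at time 0 is the integral of
    \<gamma> over \<open>{N1..N}\<close>; subtracting the part up to \<open>x\<close> leaves the
    integral over \<open>{x..N}\<close>.\<close>
  have late_split: "integral {N1..x} \<gamma> + integral {x..N} \<gamma> = integral {N1..N} \<gamma>"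
    if "N1 < x" "x \<le> N"
    by (rule Henstock_Kurzweil_Integration.integral_combine)
      (use that N1 in \<open>auto intro!: integrable_continuous_interval
        intro: continuous_on_subset[OF cont_late]\<close>)
  have empty: "integral {0..x} \<beta> = 0" if "x < 0"
    using that by simp
  have empty': "integral {x..N} \<gamma> = 0" if "N < x"
    using that by simp
  show ?thesis
    using s_pos N1 eq late_split empty empty'
    unfolding queue_delay_def early_delay_def early late at
    by (auto simp: right_diff_distrib)
qed

text \<open>Here \<open>x\<close> ranges over all reals: outside \<open>{0..N}\<close> the relevant
  integral is over an empty interval. For a balanced split the two branches agree at
  \<open>N1\<close>.\<close>

definition scaled_cost :: "real \<Rightarrow> real \<Rightarrow> real \<Rightarrow> real" where
  "scaled_cost N1 n x =
    (if x \<le> N1 then integral {0..x} \<beta> + \<beta> n * (N1 - x)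
     else integral {x..N} \<gamma> + \<gamma> n * (x - N1))"

lemma travel_cost_eq:
  assumes "balanced_split N \<beta> \<gamma> N1"
  shows "s * travel_cost \<beta> \<gamma> (queue_delay N s \<beta> \<gamma> N1) n ((x - N1) / s) = scaled_cost N1 n x"
  using queue_delay_eq[OF assms, of x] s_pos
  by (auto simp: travel_cost_def scaled_cost_def pos_part_def max_def field_simps)

lemma scaled_cost_minimal:
  assumes bal: "balanced_split N \<beta> \<gamma> N1" and n: "n \<in> {0..N}"
  shows "scaled_cost N1 n n \<le> scaled_cost N1 n x"
proof -
  have N1: "0 < N1" "N1 < N" and eq: "integral {0..N1} \<beta> = integral {N1..N} \<gamma>"
    using bal by (auto simp: balanced_split_def)
  consider "n \<le> N1" "x \<le> N1" | "n \<le> N1" "N1 < x" | "N1 < n" "N1 < x" | "N1 < n" "x \<le> N1"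
    by linarith
  then show ?thesis
  proof cases
    \<comment> \<open>On the same side of \<open>N1\<close>, the claim is the tangent inequality at
      \<open>n\<close>, rearranged.\<close>
    case 1
    then show ?thesis
      using early_tangent[of n x] n N1 by (simp add: scaled_cost_def algebra_simps)
  next
    case 2
    \<comment> \<open>Opposite sides are compared through \<open>N1\<close>: the tangent at
      \<open>n\<close> bounds the cost at \<open>n\<close> by that at \<open>N1\<close>. The tangent
      at \<open>N1\<close> and \<open>\<gamma> N1 \<le> \<gamma> n\<close> then show that the cost
      at \<open>x\<close> is no smaller.\<close>
    have "\<gamma> N1 * (x - N1) \<le> \<gamma> n * (x - N1)"
      using 2 n N1 by (intro mult_right_mono monotone_onD[OF antimono_late]) auto
    then show ?thesis
      using early_tangent[of n N1] late_tangent[of N1 x] 2 n N1 eq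
      by (simp add: scaled_cost_def algebra_simps)
  next
    case 3
    then show ?thesis
      using late_tangent[of n x] n N1 by (simp add: scaled_cost_def algebra_simps)
  next
    case 4
    have "\<beta> N1 * (N1 - x) \<le> \<beta> n * (N1 - x)"
      using 4 n N1 by (intro mult_right_mono mono_onD[OF mono_early]) auto
    then show ?thesis
      using late_tangent[of n N1] early_tangent[of N1 x] 4 n N1 eq
      by (simp add: scaled_cost_def algebra_simps)
  qed
qed

lemma balanced_split_equilibrium:
  assumes bal: "balanced_split N \<beta> \<gamma> N1"
  shows "equilibrium_principle N s \<beta> \<gamma> (arrival_time s N1) (queue_delay N s \<beta> \<gamma> N1)"
  unfolding equilibrium_principle_def is_arg_min_linorder
proof (intro ballI conjI allI impI)
  fix n assume n: "n \<in> {0..N}"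
  have "- N \<le> n - N1" "n - N1 \<le> N"
    using n bal by (auto simp: balanced_split_def)
  then show "arrival_time s N1 n \<in> time_window N s"
    using s_pos by (auto simp: arrival_time_def time_window_def divide_simps)
  fix u
  \<comment> \<open>Any time \<open>u\<close> is rewritten as the time at which position
    \<open>N1 + s * u\<close> is served, so that \<open>travel_cost_eq\<close> applies on both
    sides.\<close>
  have "u = ((N1 + s * u) - N1) / s" using s_pos by simp
  then have "s * travel_cost \<beta> \<gamma> (queue_delay N s \<beta> \<gamma> N1) n (arrival_time s N1 n)
      \<le> s * travel_cost \<beta> \<gamma> (queue_delay N s \<beta> \<gamma> N1) n u"
    using scaled_cost_minimal[OF bal n, of "N1 + s * u"] travel_cost_eq[OF bal]
    unfolding arrival_time_def by metis
  then show "travel_cost \<beta> \<gamma> (queue_delay N s \<beta> \<gamma> N1) n (arrival_time s N1 n)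
      \<le> travel_cost \<beta> \<gamma> (queue_delay N s \<beta> \<gamma> N1) n u"
    using s_pos by simp
qed

end

theorem theorem1:
  fixes N s :: real and \<beta> \<gamma> :: "real \<Rightarrow> real"
  assumes "N > 0" and "s > 0"
    and "continuous_on {0..N} \<beta>" and "strict_mono_on {0..N} \<beta>" and "\<beta> ` {0..N} \<subseteq> {0<..<1}"
    and "continuous_on {0..N} \<gamma>" and "strict_antimono_on {0..N} \<gamma>" and "\<gamma> ` {0..N} \<subseteq> {0<..}"
  shows "(\<exists>!N1. balanced_split N \<beta> \<gamma> N1) \<and>
    (\<forall>N1. balanced_split N \<beta> \<gamma> N1 \<longrightarrow>
       equilibrium_principle N s \<beta> \<gamma> (arrival_time s N1) (queue_delay N s \<beta> \<gamma> N1))"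
proof -
  interpret bottleneck N s \<beta> \<gamma>
    by unfold_locales (use assms in \<open>auto simp: image_subset_iff\<close>)
  show ?thesis using ex1_balanced_split balanced_split_equilibrium by blast
qed

end
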